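(* Let $A$ be a closed densely defined symmetric operator with equal deficiency indices in a separable Hilbert space $\mathfrak H$, let $\{\mathcal H,\Gamma_0,\Gamma_1\}$ be a boundary triplet for $A^*$, and let $B_1,B_2\in\mathcal C(\mathcal H)$ be such that the operators $A_{B_1}$ and $A_{B_2}$ have a common regular point $z\in\rho(A_{B_1})\cap\rho(A_{B_2})$. If $\rho(B_1)\cap\rho(B_2)\ne\emptyset$, then for any $\zeta\in\rho(B_1)\cap\rho(B_2)$ $$(A_{B_1}-z)^{-1}-(A_{B_2}-z)^{-1}\in\mathfrak S(\mathfrak H)\iff (B_1-\zeta)^{-1}-(B_2-\zeta)^{-1}\in\mathfrak S(\mathcal H).$$
   Context: $\mathcal C(\mathcal H)$ denotes the closed densely defined operators in $\mathcal H$ and $[\mathcal K]$ the bounded everywhere defined operators on $\mathcal K$. A boundary triplet for $A^*$ is a triple $\{\mathcal H,\Gamma_0,\Gamma_1\}$, where $\mathcal H$ is a Hilbert space and $\Gamma_0,\Gamma_1:\operatorname{dom}(A^* )\to\mathcal H$ are linear maps such that (i) $(A^*f,g)_{\mathfrak H}-(f,A^*g)_{\mathfrak H}=(\Gamma_1f,\Gamma_0g)_{\mathcal H}-(\Gamma_0f,\Gamma_1g)_{\mathcal H}$ for all $f,g\in\operatorname{dom}(A^* )$, and (ii) $f\mapsto(\Gamma_1f,\Gamma_0f)$ maps $\operatorname{dom}(A^* )$ onto $\mathcal H\oplus\mathcal H$. For $B\in\mathcal C(\mathcal H)$, $A_B$ is the restriction of $A^*$ to $\{f\in\operatorname{dom}(A^*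 ):\Gamma_0f\in\operatorname{dom}(B),\ \Gamma_1f=B\Gamma_0f\}$. $\mathfrak S$ denotes a two-sided operator ideal taken on different Hilbert spaces simultaneously: to each separable Hilbert space $\mathcal K$ it assigns a two-sided ideal $\mathfrak S(\mathcal K)$ of $[\mathcal K]$, such that $STR\in\mathfrak S(\mathcal K_2)$ whenever $T\in\mathfrak S(\mathcal K_1)$ and $S:\mathcal K_1\to\mathcal K_2$, $R:\mathcal K_2\to\mathcal K_1$ are bounded. *)

theory Defs
  imports "HOL-Analysis.Analysis"
begin

section \<open>Complex inner products on top of \<^class>\<open>real_inner\<close>\<close>

text \<open>
  The norm, the topology and completeness are those of the underlying real inner product space,
  whose inner product is the real part of the complex one. The complex inner product is linear in
  its first argument.
\<close>

class complex_inner = real_inner +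
  fixes scaleC :: "complex \<Rightarrow> 'a \<Rightarrow> 'a" (infixr "*\<^sub>C" 75)
    and cinner :: "'a \<Rightarrow> 'a \<Rightarrow> complex"
  assumes scaleC_add_right: "a *\<^sub>C (x + y) = a *\<^sub>C x + a *\<^sub>C y"
    and scaleC_add_left: "(a + b) *\<^sub>C x = a *\<^sub>C x + b *\<^sub>C x"
    and scaleC_scaleC: "a *\<^sub>C b *\<^sub>C x = (a * b) *\<^sub>C x"
    and scaleR_scaleC: "r *\<^sub>R x = complex_of_real r *\<^sub>C x"
    and cinner_add_left: "cinner (x + y) z = cinner x z + cinner y z"
    and cinner_scaleC_left: "cinner (a *\<^sub>C x) y = a * cinner x y"
    and cinner_commute: "cinner x y = cnj (cinner y x)"
    and inner_eq_Re_cinner: "x \<bullet> y = Re (cinner x y)"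

class chilbert_space = complex_inner + complete_space

instantiation complex :: chilbert_space
begin

definition scaleC_complex_def: "a *\<^sub>C (x :: complex) = a * x"
definition cinner_complex_def: "cinner (x :: complex) y = x * cnj y"

instance
  by standard
    (auto simp: scaleC_complex_def cinner_complex_def algebra_simps scaleR_conv_of_real
      inner_complex_def)

end

text \<open>
  Orthogonal direct sums: any two Hilbert spaces are closed subspaces of a common one, and the graph
  of an operator is a subset of a Hilbert space.
\<close>

instantiation prod :: (complex_inner, complex_inner) complex_inner
begin

definition scaleC_prod_def: "a *\<^sub>C p = (a *\<^sub>C fst p, a *\<^sub>C snd p)"
definition cinner_prod_def: "cinner p q = cinner (fst p) (fst q) + cinner (snd p) (snd q)"

instance
proof
  fix p q :: "'a \<times> 'b"
  show "cinner p q = cnj (cinner q p)"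
    unfolding cinner_prod_def complex_cnj_add by (metis cinner_commute)
qed (auto simp: scaleC_prod_def cinner_prod_def scaleC_add_right scaleC_add_left scaleC_scaleC
      scaleR_prod_def scaleR_scaleC cinner_add_left cinner_scaleC_left inner_prod_def
      inner_eq_Re_cinner algebra_simps)

end

instance prod :: (chilbert_space, chilbert_space) chilbert_space ..

section \<open>Hilbert spaces as closed subspaces\<close>

text \<open>
  The elements of an ambient type of class \<^class>\<open>chilbert_space\<close> serve as a universe, and a
  Hilbert space is a closed complex subspace of it. Since Hilbert spaces are terms, not types, one
  can speak of a family indexed by all (separable) Hilbert spaces, as an operator ideal requires.
\<close>

definition csubspace :: "'a::complex_inner set \<Rightarrow> bool" where
  "csubspace M \<longleftrightarrow> 0 \<in> M \<and> (\<forall>x\<in>M. \<forall>y\<in>M. x + y \<in> M) \<and> (\<forall>a. \<forall>x\<in>M. a *\<^sub>C x \<in> M)"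

definition hilbert :: "'a::chilbert_space set \<Rightarrow> bool" where
  "hilbert K \<longleftrightarrow> csubspace K \<and> closed K"

definition separable_hilbert :: "'a::chilbert_space set \<Rightarrow> bool" where
  "separable_hilbert K \<longleftrightarrow> hilbert K \<and> separable_space (top_of_set K)"

definition orthonormal_basis :: "'a::chilbert_space set \<Rightarrow> 'a set \<Rightarrow> bool" where
  "orthonormal_basis M E \<longleftrightarrow>
     E \<subseteq> M \<and> (\<forall>e\<in>E. \<forall>e'\<in>E. cinner e e' = (if e = e' then 1 else 0)) \<and>
     closure (csubspace hull E) = M"

definition equal_dimension :: "'a::chilbert_space set \<Rightarrow> 'a set \<Rightarrow> bool" where
  "equal_dimension M N \<longleftrightarrow> (\<exists>E F. orthonormal_basis M E \<and> orthonormal_basis N F \<and> E \<approx> F)"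

section \<open>Operators as graphs\<close>

text \<open>
  An operator from \<open>K\<close> to \<open>L\<close> is identified with its graph, so its domain is \<^const>\<open>Domain\<close> and
  restriction is inclusion.
\<close>

type_synonym 'a operator = "('a \<times> 'a) set"

definition linear_operator ::
    "'a::chilbert_space set \<Rightarrow> 'a set \<Rightarrow> 'a operator \<Rightarrow> bool" where
  "linear_operator K L T \<longleftrightarrow> T \<subseteq> K \<times> L \<and> csubspace T \<and> single_valued T"

definition bounded_operators ::
    "'a::chilbert_space set \<Rightarrow> 'a set \<Rightarrow> 'a operator set" where
  "bounded_operators K L =
     {T. linear_operator K L T \<and> Domain T = K \<and> (\<exists>C. \<forall>(x, y)\<in>T. norm y \<le> C * norm x)}"

definition closed_operators :: "'a::chilbert_space set \<Rightarrow> 'a operator set" where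
  "closed_operators K = {T. linear_operator K K T \<and> closed T \<and> closure (Domain T) = K}"

definition op_add :: "'a::chilbert_space operator \<Rightarrow> 'a operator \<Rightarrow> 'a operator" where
  "op_add S T = {(x, y + y') | x y y'. (x, y) \<in> S \<and> (x, y') \<in> T}"

definition op_diff :: "'a::chilbert_space operator \<Rightarrow> 'a operator \<Rightarrow> 'a operator" where
  "op_diff S T = {(x, y - y') | x y y'. (x, y) \<in> S \<and> (x, y') \<in> T}"

text \<open>Relational composition lists the operator applied first on the left.\<close>

definition op_comp :: "'a operator \<Rightarrow> 'a operator \<Rightarrow> 'a operator" where
  "op_comp S T = T O S"

definition op_shift :: "'a::chilbert_space operator \<Rightarrow> complex \<Rightarrow> 'a operator" where
  "op_shift T z = {(f, f' - z *\<^sub>C f) | f f'. (f, f') \<in> T}"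

definition resolvent :: "'a::chilbert_space operator \<Rightarrow> complex \<Rightarrow> 'a operator" where
  "resolvent T z = (op_shift T z)\<inverse>"

text \<open>
  Membership of the inverse graph in \<^const>\<open>bounded_operators\<close> says that \<open>T - z\<close> is injective and
  maps its domain onto \<open>K\<close>, with bounded inverse.
\<close>

definition resolvent_set :: "'a::chilbert_space set \<Rightarrow> 'a operator \<Rightarrow> complex set" where
  "resolvent_set K T = {z. resolvent T z \<in> bounded_operators K K}"

definition adjoint_op :: "'a::chilbert_space set \<Rightarrow> 'a operator \<Rightarrow> 'a operator" where
  "adjoint_op K T =
     {(g, g') \<in> K \<times> K. \<forall>(f, f')\<in>T. cinner f' g = cinner f g'}"

definition symmetric_op :: "'a::chilbert_space set \<Rightarrow> 'a operator \<Rightarrow> bool" where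
  "symmetric_op K A \<longleftrightarrow> A \<subseteq> adjoint_op K A"

definition defect_subspace ::
    "'a::chilbert_space set \<Rightarrow> 'a operator \<Rightarrow> complex \<Rightarrow> 'a set" where
  "defect_subspace K A z = {f. (f, z *\<^sub>C f) \<in> adjoint_op K A}"

definition equal_deficiency_indices :: "'a::chilbert_space set \<Rightarrow> 'a operator \<Rightarrow> bool" where
  "equal_deficiency_indices K A \<longleftrightarrow>
     equal_dimension (defect_subspace K A \<i>) (defect_subspace K A (- \<i>))"

section \<open>Boundary triplets\<close>

text \<open>
  The boundary maps are total functions of which only the values on the domain of the adjoint matter.
\<close>

definition linear_map_on ::
    "'a::chilbert_space set \<Rightarrow> 'a set \<Rightarrow> ('a \<Rightarrow> 'a) \<Rightarrow> bool" where
  "linear_map_on D L G \<longleftrightarrow>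
     (\<forall>f\<in>D. G f \<in> L) \<and> (\<forall>f\<in>D. \<forall>g\<in>D. G (f + g) = G f + G g) \<and>
     (\<forall>a. \<forall>f\<in>D. G (a *\<^sub>C f) = a *\<^sub>C G f)"

definition boundary_triplet ::
    "'a::chilbert_space set \<Rightarrow> 'a operator \<Rightarrow> 'a set \<Rightarrow> ('a \<Rightarrow> 'a) \<Rightarrow> ('a \<Rightarrow> 'a) \<Rightarrow> bool" where
  "boundary_triplet K A L G0 G1 \<longleftrightarrow>
     hilbert L \<and>
     linear_map_on (Domain (adjoint_op K A)) L G0 \<and>
     linear_map_on (Domain (adjoint_op K A)) L G1 \<and>
     (\<forall>(f, f')\<in>adjoint_op K A. \<forall>(g, g')\<in>adjoint_op K A.
        cinner f' g - cinner f g' = cinner (G1 f) (G0 g) - cinner (G0 f) (G1 g)) \<and>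
     (\<lambda>f. (G1 f, G0 f)) ` Domain (adjoint_op K A) = L \<times> L"

definition extension_op ::
    "'a::chilbert_space set \<Rightarrow> 'a operator \<Rightarrow> ('a \<Rightarrow> 'a) \<Rightarrow> ('a \<Rightarrow> 'a) \<Rightarrow> 'a operator \<Rightarrow> 'a operator"
  where
  "extension_op K A G0 G1 B = {(f, f') \<in> adjoint_op K A. (G0 f, G1 f) \<in> B}"

section \<open>Operator ideals\<close>

text \<open>Closure under scalar multiples follows from multiplication by multiples of the identity.\<close>

definition two_sided_ideal :: "'a::chilbert_space set \<Rightarrow> 'a operator set \<Rightarrow> bool" where
  "two_sided_ideal K J \<longleftrightarrow>
     J \<subseteq> bounded_operators K K \<and> K \<times> {0} \<in> J \<and>
     (\<forall>S\<in>J. \<forall>T\<in>J. op_add S T \<in> J) \<and>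
     (\<forall>T\<in>J. \<forall>S\<in>bounded_operators K K. op_comp S T \<in> J \<and> op_comp T S \<in> J)"

definition operator_ideal :: "('a::chilbert_space set \<Rightarrow> 'a operator set) \<Rightarrow> bool" where
  "operator_ideal \<SS> \<longleftrightarrow>
     (\<forall>K. separable_hilbert K \<longrightarrow> two_sided_ideal K (\<SS> K)) \<and>
     (\<forall>K1 K2. separable_hilbert K1 \<longrightarrow> separable_hilbert K2 \<longrightarrow>
        (\<forall>T\<in>\<SS> K1. \<forall>S\<in>bounded_operators K1 K2. \<forall>R\<in>bounded_operators K2 K1.
           op_comp S (op_comp T R) \<in> \<SS> K2))"

end

(*
  Fix zeta and write Q_j for the resolvent of B_j at zeta and R_j for that of A_{B_j} at z.
  The vector d = R_1 h - R_2 h lies in the defect subspace N_z = ker (A^* - z). On N_z the map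
  Lambda d = Gamma_0 d - Q_1 (Gamma_1 - zeta Gamma_0) d is a bounded bijection onto the boundary
  space, and applying it to d gives
     Lambda (R_1 - R_2) = (Q_1 - Q_2) V   with   V = (Gamma_1 - zeta Gamma_0) R_2,
  where V is bounded and maps onto the boundary space. The open mapping principle makes Lambda and V
  invertible up to bounded one-sided inverses, so each resolvent difference is the other one
  multiplied by bounded operators.
  The boundary space is separable because it is the image of V.
*)
theory Submission
  imports Defs
begin

section \<open>Complex inner product spaces\<close>

\<comment> \<open>The maps are paired crosswise: Lambda is built from B_1 and V from B_2. On the
  domain of A_{B_1} one has Gamma_1 = B_1 Gamma_0, so the formula for Lambda vanishes there and
  Lambda (R_1 - R_2) h reduces to Q_1 V h - Gamma_0 R_2 h; on the domain of A_{B_2} the relation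
  Gamma_1 = B_2 Gamma_0 turns the last term into Q_2 V h. No gamma field or Weyl function enters:
  these refer to the extension with boundary condition Gamma_0 f = 0, for which z is not assumed to
  be regular. Two obstacles shape the proof. Gamma_0 and Gamma_1 are continuous only for the graph
  norm of A^*, so a bounded composition with them requires control of A^* as well. And Hilbert
  spaces are closed subsets of one type, so projections, the closed graph theorem and bounded right
  inverses are established relative to such subsets.\<close>
subclass (in chilbert_space) banach ..

lemma scaleC_minus_one [simp]: "(- 1) *\<^sub>C x = - (x :: 'a::complex_inner)"
  using scaleR_scaleC[of "- 1" x] by simp

lemma scaleC_zero_left [simp]: "0 *\<^sub>C x = (0 :: 'a::complex_inner)"
  using scaleR_scaleC[of 0 x] by simp

lemma scaleC_zero_right [simp]: "a *\<^sub>C (0 :: 'a::complex_inner) = 0"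
  using scaleC_add_right[of a 0 "0 :: 'a"] by simp

lemma scaleC_minus_right: "a *\<^sub>C (- x) = - (a *\<^sub>C (x :: 'a::complex_inner))"
  using scaleC_add_right[of a x "- x"] by (simp add: eq_neg_iff_add_eq_0 add.commute)

lemma scaleC_diff_right: "a *\<^sub>C (x - y) = a *\<^sub>C x - a *\<^sub>C (y :: 'a::complex_inner)"
  using scaleC_add_right[of a x "- y"] by (simp add: scaleC_minus_right)

lemma cinner_zero_left [simp]: "cinner (0 :: 'a::complex_inner) y = 0"
  using cinner_scaleC_left[of 0 "0 :: 'a" y] by simp

lemma cinner_diff_left: "cinner (x - y) z = cinner x z - cinner (y :: 'a::complex_inner) z"
  using cinner_add_left[of "x - y" y z] by simp

lemma cinner_add_right: "cinner x (y + z) = cinner x y + cinner (x :: 'a::complex_inner) z"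
  unfolding cinner_commute[of x] by (simp add: cinner_add_left)

lemma cinner_scaleC_right: "cinner x (a *\<^sub>C y) = cnj a * cinner (x :: 'a::complex_inner) y"
  unfolding cinner_commute[of x] by (simp add: cinner_scaleC_left)

lemma cinner_zero_right [simp]: "cinner (x :: 'a::complex_inner) 0 = 0"
  using cinner_scaleC_right[of x 0 x] by simp

text \<open>Conjugate linearity in the second argument makes the imaginary part a real inner product
  with \<open>\<i> *\<^sub>C y\<close>. Continuity and orthogonality can thus be inherited from the
  real inner product.\<close>

lemma cinner_eq_Complex: "cinner x y = Complex (x \<bullet> y) (x \<bullet> (\<i> *\<^sub>C (y :: 'a::complex_inner)))"
  by (simp add: complex_eq_iff inner_eq_Re_cinner cinner_scaleC_right)

lemma continuous_on_cinner_left [continuous_intros]: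
  assumes "continuous_on S f"
  shows "continuous_on S (\<lambda>x. cinner (f x) (y :: 'a::complex_inner))"
  unfolding cinner_eq_Complex by (intro continuous_intros assms)

lemma continuous_on_cinner_right [continuous_intros]:
  assumes "continuous_on S f"
  shows "continuous_on S (\<lambda>x. cinner (y :: 'a::complex_inner) (f x))"
  unfolding cinner_commute[of y] by (intro continuous_intros assms)

lemma norm_scaleC: "norm (a *\<^sub>C x) = cmod a * norm (x :: 'a::complex_inner)"
proof -
  have "(a *\<^sub>C x) \<bullet> (a *\<^sub>C x) = Re (of_real ((cmod a)\<^sup>2) * cinner x x)"
    by (simp add: inner_eq_Re_cinner cinner_scaleC_left cinner_scaleC_right
        complex_norm_square mult_ac del: of_real_power)
  then have "(norm (a *\<^sub>C x))\<^sup>2 = (cmod a * norm x)\<^sup>2"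
    by (simp add: power2_norm_eq_inner power_mult_distrib inner_eq_Re_cinner
        del: of_real_power)
  then show ?thesis
    by (simp add: power2_eq_iff_nonneg)
qed

section \<open>Complex subspaces and nearest points\<close>

lemma csubspaceD:
  assumes "csubspace M"
  shows csubspace_0: "0 \<in> M"
    and csubspace_add: "\<And>x y. x \<in> M \<Longrightarrow> y \<in> M \<Longrightarrow> x + y \<in> M"
    and csubspace_scale: "\<And>x a. x \<in> M \<Longrightarrow> a *\<^sub>C x \<in> M"
  using assms by (auto simp: csubspace_def)

lemma csubspace_diff:
  assumes "csubspace M" "x \<in> M" "y \<in> M"
  shows "x - y \<in> M"
  using csubspace_add[OF assms(1,2) csubspace_scale[OF assms(1,3), of "- 1"]] by simp

lemma csubspace_scaleR:
  assumes "csubspace M" "x \<in> M"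
  shows "r *\<^sub>R x \<in> M"
  using csubspace_scale[OF assms] by (simp add: scaleR_scaleC)

text \<open>Replacing m by its multiple by \<open>\<i>\<close> recovers the imaginary part, so the
  projection argument may be carried out with real scalars only.\<close>

lemma csubspace_orthogonal_iff:
  assumes "csubspace M"
  shows "(\<forall>m\<in>M. cinner x m = 0) \<longleftrightarrow> (\<forall>m\<in>M. x \<bullet> m = 0)"
  using csubspace_scale[OF assms] by (auto simp: cinner_eq_Complex complex_eq_iff)

lemma hilbertD:
  assumes "hilbert K"
  shows hilbert_csubspace: "csubspace K" and hilbert_closed: "closed K"
  using assms by (auto simp: hilbert_def)

text \<open>The classical argument: a minimising sequence for the distance is Cauchy by the
  parallelogram law, and a first-order variation at its limit gives orthogonality.\<close>

theorem orthogonal_projection_exists: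
  fixes x :: "'a::chilbert_space"
  assumes "hilbert M"
  obtains p where "p \<in> M" "\<And>m. m \<in> M \<Longrightarrow> cinner (x - p) m = 0"
proof -
  note M = hilbert_csubspace[OF assms]
  define D where "D = (\<lambda>y. (norm (x - y))\<^sup>2) ` M"
  define d where "d = Inf D"
  have bdd: "bdd_below D"
    unfolding D_def by (rule bdd_belowI2[where m = 0]) simp
  have ne: "D \<noteq> {}"
    using csubspace_0[OF M] unfolding D_def by blast
  have d_le: "d \<le> (norm (x - y))\<^sup>2" if "y \<in> M" for y
    unfolding d_def by (rule cInf_lower[OF _ bdd]) (simp add: D_def that)
  have "\<exists>y\<in>M. (norm (x - y))\<^sup>2 < d + inverse (real (Suc n))" for n
    using cInf_lessD[OF ne, of "d + inverse (real (Suc n))"] by (auto simp: d_def D_def)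
  then obtain Y where YM: "\<And>n. Y n \<in> M"
    and Y: "\<And>n. (norm (x - Y n))\<^sup>2 < d + inverse (real (Suc n))"
    by metis
  \<comment> \<open>The midpoint of \<open>Y m\<close> and \<open>Y n\<close> lies in M, so its
    squared distance to x is at least d; the parallelogram law then leaves only the two excesses
    over d.\<close>
  have close: "(norm (Y m - Y n))\<^sup>2 < 2 * inverse (real (Suc m)) + 2 * inverse (real (Suc n))" for m n
  proof -
    have "(1/2) *\<^sub>R (Y m + Y n) \<in> M"
      by (intro csubspace_scaleR csubspace_add M YM)
    then have "d \<le> (norm (x - (1/2) *\<^sub>R (Y m + Y n)))\<^sup>2" by (rule d_le)
    also have "x - (1/2) *\<^sub>R (Y m + Y n) = (1/2) *\<^sub>R ((x - Y m) + (x - Y n))"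
    proof -
      have "(x - Y m) + (x - Y n) = (x + x) - (Y m + Y n)" by simp
      then show ?thesis by (simp only: scaleR_diff_right scaleR_half_double)
    qed
    finally have "4 * d \<le> (norm ((x - Y m) + (x - Y n)))\<^sup>2"
      by (simp add: power_divide)
    moreover have "(norm (Y m - Y n))\<^sup>2 = (norm ((x - Y n) - (x - Y m)))\<^sup>2" by simp
    moreover have parallelogram: "(norm (v - u))\<^sup>2 = 2 * (norm u)\<^sup>2 + 2 * (norm v)\<^sup>2 - (norm (u + v))\<^sup>2" for u v :: 'a
      by (simp add: power2_norm_eq_inner inner_diff_left inner_diff_right inner_add_left
          inner_add_right inner_commute[of v u])
    ultimately show ?thesis using Y[of m] Y[of n] parallelogram[of "x - Y n" "x - Y m"] by linarith
  qed
  have "Cauchy Y"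
  proof (rule CauchyI)
    fix e :: real assume "e > 0"
    \<comment> \<open>Each of the two terms in \<open>close\<close> carries a factor 2, so a quarter
      of \<open>e\<^sup>2\<close> bounds their sum.\<close>
    then obtain N where N: "inverse (real (Suc N)) < e\<^sup>2 / 4"
      using reals_Archimedean[of "e\<^sup>2 / 4"] by auto
    have "norm (Y m - Y n) < e" if "m \<ge> N" "n \<ge> N" for m n
    proof -
      have "inverse (real (Suc m)) \<le> inverse (real (Suc N))" "inverse (real (Suc n)) \<le> inverse (real (Suc N))"
        using that by (auto intro!: le_imp_inverse_le)
      then have "(norm (Y m - Y n))\<^sup>2 < e\<^sup>2"
        using close[of m n] N by linarith
      then show ?thesis using \<open>e > 0\<close> by (simp add: power_less_imp_less_base)
    qed
    then show "\<exists>N. \<forall>m\<ge>N. \<forall>n\<ge>N. norm (Y m - Y n) < e" by blast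
  qed
  then obtain p where p: "Y \<longlonglongrightarrow> p" by (auto simp: Cauchy_convergent_iff convergent_def)
  have pM: "p \<in> M"
    by (rule closed_sequentially[OF hilbert_closed[OF assms] YM p])
  have "(norm (x - p))\<^sup>2 \<le> d"
  proof (rule LIMSEQ_le)
    show "(\<lambda>n. (norm (x - Y n))\<^sup>2) \<longlonglongrightarrow> (norm (x - p))\<^sup>2"
      by (intro tendsto_intros p)
    show "(\<lambda>n. d + inverse (real (Suc n))) \<longlonglongrightarrow> d"
      using tendsto_add[OF tendsto_const LIMSEQ_inverse_real_of_nat] by simp
    show "\<exists>N. \<forall>n\<ge>N. (norm (x - Y n))\<^sup>2 \<le> d + inverse (real (Suc n))"
      using Y by (simp add: less_imp_le)
  qed
  have "(x - p) \<bullet> m = 0" if m: "m \<in> M" for m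
  proof (cases "m = 0")
    case False
    \<comment> \<open>This t minimises the quadratic function giving the squared norm of
      \<open>(x - p) - t *\<^sub>R m\<close>. Since p is already a best approximation, the resulting
      decrease must be zero.\<close>
    define t where "t = ((x - p) \<bullet> m) / (m \<bullet> m)"
    have "p + t *\<^sub>R m \<in> M" by (intro csubspace_scaleR csubspace_add M pM m)
    then have "(norm (x - p))\<^sup>2 \<le> (norm (x - (p + t *\<^sub>R m)))\<^sup>2"
      by (rule order_trans[OF \<open>(norm (x - p))\<^sup>2 \<le> d\<close> d_le])
    also have "x - (p + t *\<^sub>R m) = (x - p) - t *\<^sub>R m" by simp
    also have "(norm ((x - p) - t *\<^sub>R m))\<^sup>2 = (norm (x - p))\<^sup>2 - 2 * t * ((x - p) \<bullet> m) + t * t * (m \<bullet> m)"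
      unfolding power2_norm_eq_inner
      by (simp only: inner_diff_left[of "x - p" "t *\<^sub>R m"] inner_diff_right[of _ "x - p" "t *\<^sub>R m"]
          inner_commute[of m "x - p"] inner_scaleR_left inner_scaleR_right) (simp add: algebra_simps)
    also have "t * t * (m \<bullet> m) = t * ((x - p) \<bullet> m)"
      using False by (simp add: t_def)
    finally have "t * ((x - p) \<bullet> m) \<le> 0" by simp
    then have "((x - p) \<bullet> m)\<^sup>2 / (m \<bullet> m) \<le> 0" by (simp add: t_def power2_eq_square)
    moreover have "m \<bullet> m > 0" using False by simp
    ultimately show ?thesis by (simp add: divide_le_0_iff)
  qed simp
  then have "\<forall>m\<in>M. cinner (x - p) m = 0"
    by (simp add: csubspace_orthogonal_iff[OF M])
  then show ?thesis using that[OF pM] by simp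
qed

section \<open>Bounded maps between Hilbert spaces\<close>

definition bounded_map_on ::
    "'a::chilbert_space set \<Rightarrow> 'a set \<Rightarrow> ('a \<Rightarrow> 'a) \<Rightarrow> bool" where
  "bounded_map_on K L F \<longleftrightarrow> linear_map_on K L F \<and> (\<exists>C. \<forall>x\<in>K. norm (F x) \<le> C * norm x)"

lemma linear_map_onD:
  assumes "linear_map_on K L F"
  shows linear_map_on_in: "\<And>x. x \<in> K \<Longrightarrow> F x \<in> L"
    and linear_map_on_add: "\<And>x y. x \<in> K \<Longrightarrow> y \<in> K \<Longrightarrow> F (x + y) = F x + F y"
    and linear_map_on_scale: "\<And>a x. x \<in> K \<Longrightarrow> F (a *\<^sub>C x) = a *\<^sub>C F x"
  using assms by (auto simp: linear_map_on_def)

lemma linear_map_on_diff: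
  assumes "csubspace K" "linear_map_on K L F" "x \<in> K" "y \<in> K"
  shows "F (x - y) = F x - F y"
  using linear_map_on_add[OF assms(2), of x "- 1 *\<^sub>C y"] linear_map_on_scale[OF assms(2), of y "- 1"]
    csubspace_scale[OF assms(1,4), of "- 1"] assms by simp

lemma linear_map_on_0:
  assumes "csubspace K" "linear_map_on K L F"
  shows "F 0 = 0"
  using linear_map_on_scale[OF assms(2) csubspace_0[OF assms(1)], of 0] by simp

lemma linear_map_on_compose:
  assumes "linear_map_on K L F" "linear_map_on L M G"
  shows "linear_map_on K M (\<lambda>x. G (F x))"
  using assms by (simp add: linear_map_on_def)

lemma bounded_map_on_linear: "bounded_map_on K L F \<Longrightarrow> linear_map_on K L F"
  by (simp add: bounded_map_on_def)

lemma bounded_map_onI: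
  "linear_map_on K L F \<Longrightarrow> (\<And>x. x \<in> K \<Longrightarrow> norm (F x) \<le> C * norm x) \<Longrightarrow> bounded_map_on K L F"
  by (auto simp: bounded_map_on_def)

lemma bounded_map_on_bound:
  assumes "bounded_map_on K L F"
  obtains C where "C \<ge> 0" "\<And>x. x \<in> K \<Longrightarrow> norm (F x) \<le> C * norm x"
proof -
  obtain C where C: "\<And>x. x \<in> K \<Longrightarrow> norm (F x) \<le> C * norm x"
    using assms by (auto simp: bounded_map_on_def)
  have "norm (F x) \<le> \<bar>C\<bar> * norm x" if "x \<in> K" for x
    by (rule order_trans[OF C[OF that]]) (simp add: mult_right_mono)
  then show ?thesis using that[of "\<bar>C\<bar>"] by simp
qed

lemma bounded_map_on_ident: "K \<subseteq> L \<Longrightarrow> bounded_map_on K L (\<lambda>x. x)"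
  by (intro bounded_map_onI[where C = 1]) (auto simp: linear_map_on_def)

lemma bounded_map_on_compose:
  assumes F: "bounded_map_on K L F" and G: "bounded_map_on L M G"
  shows "bounded_map_on K M (\<lambda>x. G (F x))"
proof -
  obtain C where C: "C \<ge> 0" "\<And>x. x \<in> K \<Longrightarrow> norm (F x) \<le> C * norm x"
    using bounded_map_on_bound[OF F] by blast
  obtain C' where C': "C' \<ge> 0" "\<And>x. x \<in> L \<Longrightarrow> norm (G x) \<le> C' * norm x"
    using bounded_map_on_bound[OF G] by blast
  have "norm (G (F x)) \<le> (C' * C) * norm x" if "x \<in> K" for x
    using C'(2)[OF linear_map_on_in[OF bounded_map_on_linear[OF F] that]]
      mult_left_mono[OF C(2)[OF that] C'(1)] by (simp add: mult.assoc)
  then show ?thesis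
    using linear_map_on_compose[OF bounded_map_on_linear[OF F] bounded_map_on_linear[OF G]]
    by (auto simp: bounded_map_on_def)
qed

lemma bounded_map_on_add:
  assumes F: "bounded_map_on K L F" and G: "bounded_map_on K L G" and L: "csubspace L"
  shows "bounded_map_on K L (\<lambda>x. F x + G x)"
proof -
  obtain C where C: "C \<ge> 0" "\<And>x. x \<in> K \<Longrightarrow> norm (F x) \<le> C * norm x"
    using bounded_map_on_bound[OF F] by blast
  obtain C' where C': "C' \<ge> 0" "\<And>x. x \<in> K \<Longrightarrow> norm (G x) \<le> C' * norm x"
    using bounded_map_on_bound[OF G] by blast
  have "norm (F x + G x) \<le> (C + C') * norm x" if "x \<in> K" for x
    using C(2)[OF that] C'(2)[OF that] norm_triangle_ineq[of "F x" "G x"]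
    by (simp add: algebra_simps)
  then show ?thesis
    using bounded_map_on_linear[OF F] bounded_map_on_linear[OF G] csubspace_add[OF L]
    by (intro bounded_map_onI[where C = "C + C'"]) (auto simp: linear_map_on_def scaleC_add_right algebra_simps)
qed

lemma bounded_map_on_scale:
  assumes F: "bounded_map_on K L F" and L: "csubspace L"
  shows "bounded_map_on K L (\<lambda>x. a *\<^sub>C F x)"
proof -
  obtain C where C: "C \<ge> 0" "\<And>x. x \<in> K \<Longrightarrow> norm (F x) \<le> C * norm x"
    using bounded_map_on_bound[OF F] by blast
  have "norm (a *\<^sub>C F x) \<le> (cmod a * C) * norm x" if "x \<in> K" for x
    using mult_left_mono[OF C(2)[OF that], of "cmod a"] by (simp add: norm_scaleC mult.assoc)
  then show ?thesis
    using bounded_map_on_linear[OF F] csubspace_scale[OF L]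
    by (intro bounded_map_onI[where C = "cmod a * C"]) (auto simp: linear_map_on_def scaleC_add_right scaleC_scaleC mult.commute)
qed

lemma bounded_map_on_diff:
  assumes "bounded_map_on K L F" "bounded_map_on K L G" "csubspace L"
  shows "bounded_map_on K L (\<lambda>x. F x - G x)"
  using bounded_map_on_add[OF assms(1) bounded_map_on_scale[OF assms(2,3), of "- 1"] assms(3)]
  by simp

section \<open>Continuity, the closed graph theorem and bounded right inverses\<close>

lemma bounded_map_on_continuous:
  assumes K: "csubspace K" and F: "bounded_map_on K L F"
  shows "continuous_on K F"
proof -
  obtain C where C: "C \<ge> 0" "\<And>x. x \<in> K \<Longrightarrow> norm (F x) \<le> C * norm x"
    using bounded_map_on_bound[OF F] by blast
  have "C-lipschitz_on K F"
  proof (rule lipschitz_onI[OF _ C(1)])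
    fix x y assume "x \<in> K" "y \<in> K"
    then show "dist (F x) (F y) \<le> C * dist x y"
      using C(2)[OF csubspace_diff[OF K]] linear_map_on_diff[OF K bounded_map_on_linear[OF F]]
      by (simp add: dist_norm)
  qed
  then show ?thesis by (rule lipschitz_on_continuous_on)
qed

text \<open>The sublevel sets of the norm of F exhaust K, so by Baire the closure of one of them
  contains a relative ball. This yields only approximate preimages with controlled values; iterating
  the approximation and using closedness of the graph turns this into a bound for F itself.\<close>

theorem closed_graph:
  assumes K: "hilbert K" and F: "linear_map_on K L F"
    and closed: "closed {(x, F x) | x. x \<in> K}"
  shows "bounded_map_on K L F"
proof -
  note cK = hilbert_csubspace[OF K]
  define E where "E n = {x \<in> K. norm (F x) \<le> real n}" for n
  have "\<exists>n. top_of_set K interior_of closure (E n) \<noteq> {}"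
  proof (rule ccontr)
    assume "\<not> ?thesis"
    then have e: "\<And>n. top_of_set K interior_of closure (E n) = {}" by blast
    have sub: "closure (E n) \<subseteq> K" for n
      by (rule closure_minimal) (auto simp: E_def hilbert_closed[OF K])
    have "top_of_set K interior_of \<Union>(range (\<lambda>n. closure (E n))) = {}"
    proof (rule Baire_category_alt)
      have "completely_metrizable_space (top_of_set K)"
        by (intro completely_metrizable_space_closedin completely_metrizable_space_euclidean)
          (use hilbert_closed[OF K] closed_closedin in auto)
      then show "completely_metrizable_space (top_of_set K) \<or>
        locally_compact_space (top_of_set K) \<and> regular_space (top_of_set K)" ..
    qed (use e sub in \<open>auto intro!: closed_subset\<close>)
    moreover have "\<Union>(range (\<lambda>n. closure (E n))) = K"
    proof
      show "K \<subseteq> \<Union>(range (\<lambda>n. closure (E n)))"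
      proof
        fix x assume "x \<in> K"
        moreover obtain n where "norm (F x) \<le> real n" using real_arch_simple by blast
        ultimately have "x \<in> E n" by (simp add: E_def)
        then show "x \<in> \<Union>(range (\<lambda>n. closure (E n)))" using closure_subset by blast
      qed
    qed (use sub in auto)
    ultimately have "K = {}"
      by (metis interior_of_topspace topspace_euclidean_subtopology)
    then show False using csubspace_0[OF cK] by simp
  qed
  then obtain n x0 where "x0 \<in> top_of_set K interior_of closure (E n)" by blast
  then obtain U where "openin (top_of_set K) U" "x0 \<in> U" "U \<subseteq> closure (E n)"
    by (auto simp: interior_of_def)
  then obtain r where r: "r > 0" and x0: "x0 \<in> K"
    and ball: "\<And>y. y \<in> K \<Longrightarrow> dist y x0 < r \<Longrightarrow> y \<in> closure (E n)"
    unfolding openin_euclidean_subtopology_iff by blast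
  \<comment> \<open>The ball around x0 is moved to the origin by subtracting approximants of x0 from
    approximants of \<open>x0 + x\<close>, which doubles the bound n.\<close>
  have approx1: "\<exists>y\<in>K. norm (x - y) < e \<and> norm (F y) \<le> 2 * real n"
    if x: "x \<in> K" "norm x < r" and e: "e > 0" for x e
  proof -
    have "x0 + x \<in> closure (E n)" "x0 \<in> closure (E n)"
      using ball[of "x0 + x"] ball[of x0] x x0 r csubspace_add[OF cK] by (auto simp: dist_norm)
    then obtain a b where ab: "a \<in> E n" "dist a (x0 + x) < e / 2" "b \<in> E n" "dist b x0 < e / 2"
      using e unfolding closure_approachable by (meson half_gt_zero)
    have "norm (x - (a - b)) = norm ((b - x0) - (a - (x0 + x)))" by (simp add: algebra_simps)
    also have "\<dots> < e"
      using ab norm_triangle_ineq4[of "b - x0" "a - (x0 + x)"] by (simp add: dist_norm)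
    finally have "norm (x - (a - b)) < e" .
    moreover have "norm (F (a - b)) \<le> 2 * real n"
      using ab linear_map_on_diff[OF cK F, of a b] norm_triangle_ineq4[of "F a" "F b"]
      by (simp add: E_def)
    moreover have "a - b \<in> K" using ab csubspace_diff[OF cK] by (simp add: E_def)
    ultimately show ?thesis by blast
  qed
  \<comment> \<open>Below, x is scaled by t to norm r / 2 and approximated within r / 4, half of
    that norm. Scaling back turns the bound 2 n into 2 n / t, which is 4 n / r times the norm of
    x.\<close>
  define C where "C = 4 * real n / r"
  have C: "C \<ge> 0" using r by (simp add: C_def)
  have "\<exists>y\<in>K. norm (x - y) \<le> norm x / 2 \<and> norm (F y) \<le> C * norm x" if x: "x \<in> K" for x
  proof (cases "x = 0")
    case True
    then show ?thesis using csubspace_0[OF cK] linear_map_on_0[OF cK F] by auto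
  next
    case False
    define t where "t = r / (2 * norm x)"
    have t: "t > 0" using r False by (simp add: t_def)
    have "norm (t *\<^sub>R x) < r" using r False by (simp add: t_def)
    then obtain y where y: "y \<in> K" "norm (t *\<^sub>R x - y) < r / 4" "norm (F y) \<le> 2 * real n"
      using approx1[OF csubspace_scaleR[OF cK x], of t "r / 4"] r by auto
    define y' where "y' = (1 / t) *\<^sub>R y"
    have "x - y' = (1 / t) *\<^sub>R (t *\<^sub>R x - y)"
      using t by (simp add: y'_def scaleR_diff_right)
    then have "norm (x - y') = norm (t *\<^sub>R x - y) / t" using t by simp
    also have "\<dots> \<le> (r / 4) / t" using y(2) t by (intro divide_right_mono) auto
    also have "\<dots> = norm x / 2" using r by (simp add: t_def)
    finally have 1: "norm (x - y') \<le> norm x / 2" .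
    have "F y' = (1 / t) *\<^sub>R F y"
      unfolding y'_def scaleR_scaleC using linear_map_on_scale[OF F y(1)] .
    then have "norm (F y') = norm (F y) / t" using t by simp
    also have "\<dots> \<le> 2 * real n / t" using y(3) t by (intro divide_right_mono) auto
    also have "\<dots> = C * norm x" using r by (simp add: t_def C_def)
    finally have "norm (F y') \<le> C * norm x" .
    moreover have "y' \<in> K" unfolding y'_def by (rule csubspace_scaleR[OF cK y(1)])
    ultimately show ?thesis using 1 by blast
  qed
  then obtain g where g: "\<And>x. x \<in> K \<Longrightarrow> g x \<in> K"
    "\<And>x. x \<in> K \<Longrightarrow> norm (x - g x) \<le> norm x / 2"
    "\<And>x. x \<in> K \<Longrightarrow> norm (F (g x)) \<le> C * norm x"
    by metis
  have "norm (F x) \<le> (2 * C) * norm x" if x: "x \<in> K" for x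
  proof -
    \<comment> \<open>The remainder after k rounds of approximation. It is at least halved each
      time, and the pieces \<open>g (u i)\<close> telescope to \<open>x - u k\<close>.\<close>
    define u where "u k = ((\<lambda>x. x - g x) ^^ k) x" for k
    have u_Suc: "u (Suc k) = u k - g (u k)" for k by (simp add: u_def)
    have uK: "u k \<in> K" for k
    proof (induction k)
      case (Suc k)
      then show ?case using csubspace_diff[OF cK _ g(1)] by (simp add: u_Suc)
    qed (simp add: u_def x)
    have u_le: "norm (u k) \<le> norm x * (1/2) ^ k" for k
    proof (induction k)
      case (Suc k)
      then show ?case using g(2)[OF uK[of k]] by (simp add: u_Suc)
    qed (simp add: u_def)
    have geo: "(\<lambda>k. C * norm x * (1/2::real) ^ k) sums (2 * C * norm x)"
      using sums_mult[OF geometric_sums[of "1/2::real"], of "C * norm x"] by (simp add: mult_ac)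
    have le: "norm (F (g (u k))) \<le> C * norm x * (1/2) ^ k" for k
      using g(3)[OF uK[of k]] mult_left_mono[OF u_le[of k] C] by (simp add: mult.assoc)
    have summ: "summable (\<lambda>k. F (g (u k)))"
      by (rule summable_comparison_test'[OF sums_summable[OF geo], of 0]) (use le in auto)
    have partial: "(\<Sum>i<k. F (g (u i))) = F (x - u k)" for k
    proof (induction k)
      case 0
      then show ?case using linear_map_on_0[OF cK F] by (simp add: u_def)
    next
      case (Suc k)
      have "F (x - u (Suc k)) = F ((x - u k) + g (u k))" by (simp add: u_Suc algebra_simps)
      also have "\<dots> = F (x - u k) + F (g (u k))"
        by (rule linear_map_on_add[OF F csubspace_diff[OF cK x uK] g(1)[OF uK]])
      finally show ?case using Suc by simp
    qed
    have lim1: "(\<lambda>k. F (x - u k)) \<longlonglongrightarrow> (\<Sum>k. F (g (u k)))"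
      using summable_LIMSEQ[OF summ] by (simp add: partial)
    have "u \<longlonglongrightarrow> 0"
    proof (rule Lim_null_comparison)
      show "(\<lambda>k. norm x * (1/2::real) ^ k) \<longlonglongrightarrow> 0"
        by (intro tendsto_mult_right_zero LIMSEQ_power_zero) simp
    qed (simp add: u_le)
    then have lim2: "(\<lambda>k. x - u k) \<longlonglongrightarrow> x"
      using tendsto_diff[OF tendsto_const[of x]] by fastforce
    \<comment> \<open>Only here is the graph hypothesis used: the arguments \<open>x - u k\<close>
      tend to x and their values converge, so the limit of the values is the value at x.\<close>
    have "(x, \<Sum>k. F (g (u k))) \<in> {(x, F x) | x. x \<in> K}"
      by (rule closed_sequentially[OF closed _ tendsto_Pair[OF lim2 lim1]])
        (use csubspace_diff[OF cK x uK] in auto)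
    then have "F x = (\<Sum>k. F (g (u k)))" by simp
    also have "norm \<dots> \<le> (\<Sum>k. C * norm x * (1/2) ^ k)"
      by (rule norm_suminf_le[OF le sums_summable[OF geo]])
    also have "\<dots> = 2 * C * norm x" by (rule sums_unique[OF geo, symmetric])
    finally show ?thesis .
  qed
  then show ?thesis using F by (auto simp: bounded_map_on_def)
qed

text \<open>Uniqueness of the point with orthogonal residual gives linearity. The projection serves
  twice: to select preimages orthogonal to a kernel, and to extend a map from the defect subspace to
  the whole space.\<close>

lemma orthogonal_projection:
  assumes M: "hilbert M"
  obtains P where "bounded_map_on UNIV M P" "\<And>x. x \<in> M \<Longrightarrow> P x = x"
proof -
  note cM = hilbert_csubspace[OF M]
  have "\<exists>p. p \<in> M \<and> (\<forall>m\<in>M. cinner (x - p) m = 0)" for x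
    using orthogonal_projection_exists[OF M, of x] by metis
  then obtain P where PM: "\<And>x. P x \<in> M" and P: "\<And>x m. m \<in> M \<Longrightarrow> cinner (x - P x) m = 0"
    by metis
  have unique: "P x = p" if p: "p \<in> M" "\<And>m. m \<in> M \<Longrightarrow> cinner (x - p) m = 0" for x p
  proof -
    have d: "p - P x \<in> M" by (rule csubspace_diff[OF cM p(1) PM])
    have "cinner (p - P x) (p - P x) = cinner (x - P x) (p - P x) - cinner (x - p) (p - P x)"
      by (simp flip: cinner_diff_left)
    also have "\<dots> = 0" using P[OF d] p(2)[OF d] by simp
    finally have "(p - P x) \<bullet> (p - P x) = 0" by (simp add: inner_eq_Re_cinner)
    then show ?thesis by simp
  qed
  have "norm (P x) \<le> 1 * norm x" for x
  proof -
    have "(x - P x) \<bullet> P x = 0" using P[OF PM] by (simp add: inner_eq_Re_cinner)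
    then have "norm (P x) * norm (P x) = x \<bullet> P x"
      by (simp add: inner_diff_left dot_square_norm power2_eq_square)
    also have "\<dots> \<le> norm x * norm (P x)" by (rule norm_cauchy_schwarz)
    finally show ?thesis by (cases "P x = 0") auto
  qed
  moreover have "P (x + y) = P x + P y" for x y
  proof (rule unique)
    fix m assume m: "m \<in> M"
    have "x + y - (P x + P y) = (x - P x) + (y - P y)" by simp
    then show "cinner (x + y - (P x + P y)) m = 0"
      by (simp only: cinner_add_left P[OF m]) simp
  qed (intro csubspace_add[OF cM] PM)
  moreover have "P (a *\<^sub>C x) = a *\<^sub>C P x" for a x
  proof (rule unique)
    fix m assume m: "m \<in> M"
    show "cinner (a *\<^sub>C x - a *\<^sub>C P x) m = 0"
      by (simp only: cinner_scaleC_left P[OF m] flip: scaleC_diff_right) simp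
  qed (intro csubspace_scale[OF cM] PM)
  ultimately have "bounded_map_on UNIV M P"
    using PM by (intro bounded_map_onI[where C = 1]) (auto simp: linear_map_on_def)
  moreover have "P x = x" if "x \<in> M" for x by (rule unique) (use that in auto)
  ultimately show ?thesis by (rule that)
qed

lemma bounded_map_on_subset:
  "bounded_map_on K L F \<Longrightarrow> K' \<subseteq> K \<Longrightarrow> L \<subseteq> L' \<Longrightarrow> bounded_map_on K' L' F"
  unfolding bounded_map_on_def linear_map_on_def by blast

lemma bounded_map_on_tendsto:
  assumes "csubspace K" "bounded_map_on K L F" "X \<longlonglongrightarrow> x" "\<And>n. X n \<in> K" "x \<in> K"
  shows "(\<lambda>n. F (X n)) \<longlonglongrightarrow> F x"
  using bounded_map_on_continuous[OF assms(1,2)] assms(3-5)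
  by (simp add: continuous_on_sequentially comp_def)

lemma hilbert_kernel:
  assumes K: "hilbert K" and F: "bounded_map_on K L F"
  shows "hilbert {x \<in> K. F x = 0}"
proof -
  have "closed {x \<in> K. F x = 0}"
    unfolding closed_sequential_limits
  proof (intro allI impI)
    fix X l assume X: "(\<forall>n. X n \<in> {x \<in> K. F x = 0}) \<and> X \<longlonglongrightarrow> l"
    then have l: "l \<in> K" using closed_sequentially[OF hilbert_closed[OF K], of X l] by auto
    have "(\<lambda>n. F (X n)) \<longlonglongrightarrow> F l"
      by (rule bounded_map_on_tendsto[OF hilbert_csubspace[OF K] F]) (use X l in auto)
    then have "F l = 0" using X by (simp add: LIMSEQ_const_iff)
    then show "l \<in> {x \<in> K. F x = 0}" using l by simp
  qed
  moreover have "csubspace {x \<in> K. F x = 0}"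
    using csubspaceD[OF hilbert_csubspace[OF K]] linear_map_onD[OF bounded_map_on_linear[OF F]]
      linear_map_on_0[OF hilbert_csubspace[OF K] bounded_map_on_linear[OF F]]
    by (auto simp: csubspace_def)
  ultimately show ?thesis by (simp add: hilbert_def)
qed

text \<open>The open mapping principle in the form needed for factorisations. Among the preimages of
  y the one orthogonal to the kernel of F is unique, hence depends linearly on y; its graph is
  closed because F and the projection P are continuous.\<close>

theorem bounded_right_inverse:
  assumes K: "hilbert K" and L: "hilbert L" and F: "bounded_map_on K L F" and onto: "F ` K = L"
  obtains S where "bounded_map_on L K S" "\<And>y. y \<in> L \<Longrightarrow> F (S y) = y"
proof -
  note cK = hilbert_csubspace[OF K] and cL = hilbert_csubspace[OF L]
  note lF = bounded_map_on_linear[OF F]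
  obtain P where P: "bounded_map_on UNIV {x \<in> K. F x = 0} P"
    and P_id: "\<And>x. x \<in> {x \<in> K. F x = 0} \<Longrightarrow> P x = x"
    using orthogonal_projection[OF hilbert_kernel[OF K F]] by metis
  note lP = bounded_map_on_linear[OF P]
  have c: "csubspace (UNIV :: 'a set)" by (simp add: csubspace_def)
  \<comment> \<open>The difference of u and v lies in the kernel of F, so P fixes it, while P also
    sends it to 0.\<close>
  have unique: "u = v" if "u \<in> K" "v \<in> K" "P u = 0" "P v = 0" "F u = F v" for u v
    using P_id[of "u - v"] that csubspace_diff[OF cK, of u v] linear_map_on_diff[OF cK lF, of u v]
      linear_map_on_diff[OF c lP, of u v] by simp
  have "\<exists>x. x \<in> K \<and> P x = 0 \<and> F x = y" if y: "y \<in> L" for y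
  proof -
    obtain x where x: "x \<in> K" "F x = y" using onto y by auto
    have Px: "P x \<in> K" "F (P x) = 0" using linear_map_on_in[OF lP, of x] by auto
    then have "P (P x) = P x" using P_id by simp
    then show ?thesis
      using x Px csubspace_diff[OF cK] linear_map_on_diff[OF cK lF] linear_map_on_diff[OF c lP]
      by (intro exI[of _ "x - P x"]) simp
  qed
  then obtain S where S: "\<And>y. y \<in> L \<Longrightarrow> S y \<in> K" "\<And>y. y \<in> L \<Longrightarrow> P (S y) = 0"
    "\<And>y. y \<in> L \<Longrightarrow> F (S y) = y"
    by metis
  have "linear_map_on L K S"
    unfolding linear_map_on_def
  proof (intro conjI ballI allI)
    fix x y assume xy: "x \<in> L" "y \<in> L"
    show "S (x + y) = S x + S y"
      by (rule unique) (use xy S csubspace_add[OF cL] csubspace_add[OF cK]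
          linear_map_on_add[OF lF] linear_map_on_add[OF lP] in simp_all)
  next
    fix x a assume x: "x \<in> L"
    show "S (a *\<^sub>C x) = a *\<^sub>C S x"
      by (rule unique) (use x S csubspace_scale[OF cL] csubspace_scale[OF cK]
          linear_map_on_scale[OF lF] linear_map_on_scale[OF lP] in simp_all)
  qed (rule S(1))
  moreover have "closed {(y, S y) | y. y \<in> L}"
    unfolding closed_sequential_limits
  proof (intro allI impI)
    fix X l assume X: "(\<forall>n. X n \<in> {(y, S y) | y. y \<in> L}) \<and> X \<longlonglongrightarrow> l"
    have fst: "(\<lambda>n. fst (X n)) \<longlonglongrightarrow> fst l" and snd: "(\<lambda>n. snd (X n)) \<longlonglongrightarrow> snd l"
      using X by (auto intro: tendsto_intros)
    have XL: "fst (X n) \<in> L" "snd (X n) = S (fst (X n))" for n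
      using X[THEN conjunct1, rule_format, of n] by auto
    have l: "fst l \<in> L" by (rule closed_sequentially[OF hilbert_closed[OF L] XL(1) fst])
    have XK: "snd (X n) \<in> K" for n by (simp add: XL S)
    have lK: "snd l \<in> K" by (rule closed_sequentially[OF hilbert_closed[OF K] XK snd])
    have "(\<lambda>n. F (snd (X n))) \<longlonglongrightarrow> F (snd l)"
      by (rule bounded_map_on_tendsto[OF cK F snd XK lK])
    then have "F (snd l) = fst l"
      using LIMSEQ_unique[OF _ fst] by (simp add: XL S)
    moreover have "(\<lambda>n. P (snd (X n))) \<longlonglongrightarrow> P (snd l)"
      by (rule bounded_map_on_tendsto[OF c P snd]) auto
    then have "P (snd l) = 0" by (simp add: XL S LIMSEQ_const_iff)
    ultimately have "snd l = S (fst l)" by (intro unique[OF lK S(1)[OF l]]) (use l S in auto)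
    then show "l \<in> {(y, S y) | y. y \<in> L}" using l by (cases l) auto
  qed
  ultimately have "bounded_map_on L K S" by (intro closed_graph[OF L])
  then show ?thesis using that S(3) by blast
qed

section \<open>Everywhere defined operators as graphs of maps\<close>

text \<open>Passing from functions to graphs discards the values outside K, so a factorisation that
  holds pointwise on K becomes an equality of operators.\<close>

definition graph_on :: "'a::chilbert_space set \<Rightarrow> ('a \<Rightarrow> 'a) \<Rightarrow> 'a operator" where
  "graph_on K F = {(x, F x) | x. x \<in> K}"

lemma graph_on_cong: "(\<And>x. x \<in> K \<Longrightarrow> F x = G x) \<Longrightarrow> graph_on K F = graph_on K G"
  by (force simp: graph_on_def)

lemma graph_on_in_bounded_operators:
  assumes K: "csubspace K" and F: "bounded_map_on K L F"
  shows "graph_on K F \<in> bounded_operators K L"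
proof -
  note lF = bounded_map_on_linear[OF F]
  have "csubspace (graph_on K F)"
    unfolding csubspace_def graph_on_def
    using csubspaceD[OF K] linear_map_onD[OF lF] linear_map_on_0[OF K lF]
    by (auto simp: scaleC_prod_def zero_prod_def)
  moreover have "Domain (graph_on K F) = K" "single_valued (graph_on K F)" "graph_on K F \<subseteq> K \<times> L"
    using linear_map_on_in[OF lF] by (auto simp: graph_on_def single_valued_def)
  moreover have "\<exists>C. \<forall>(x, y)\<in>graph_on K F. norm y \<le> C * norm x"
    using F by (auto simp: bounded_map_on_def graph_on_def)
  ultimately show ?thesis by (simp add: bounded_operators_def linear_operator_def)
qed

lemma bounded_operatorsE:
  assumes "T \<in> bounded_operators K L"
  obtains F where "bounded_map_on K L F" "T = graph_on K F"
proof -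
  have TKL: "T \<subseteq> K \<times> L" and cT: "csubspace T" and sv: "single_valued T" and dom: "Domain T = K"
    and "\<exists>C. \<forall>(x, y)\<in>T. norm y \<le> C * norm x"
    using assms by (auto simp: bounded_operators_def linear_operator_def)
  then obtain C where C: "\<And>x y. (x, y) \<in> T \<Longrightarrow> norm y \<le> C * norm x" by blast
  obtain F where F: "\<And>x. x \<in> K \<Longrightarrow> (x, F x) \<in> T"
    using bchoice[of K "\<lambda>x y. (x, y) \<in> T"] dom by blast
  have F_eq: "y = F x" if "(x, y) \<in> T" for x y
    using F[of x] that TKL single_valuedD[OF sv] by blast
  have "F (x + y) = F x + F y" if "x \<in> K" "y \<in> K" for x y
    using csubspace_add[OF cT F[OF that(1)] F[OF that(2)]] F_eq by simp
  moreover have "F (a *\<^sub>C x) = a *\<^sub>C F x" if "x \<in> K" for a x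
    using csubspace_scale[OF cT F[OF that], of a] F_eq by (simp add: scaleC_prod_def)
  moreover have "F x \<in> L" if "x \<in> K" for x
    using F[OF that] TKL by blast
  ultimately have "bounded_map_on K L F"
    using F C by (intro bounded_map_onI[where C = C]) (auto simp: linear_map_on_def)
  moreover have "T = graph_on K F"
    using F F_eq TKL by (auto simp: graph_on_def)
  ultimately show ?thesis by (rule that)
qed

lemma op_comp_graph_on:
  assumes "\<And>x. x \<in> K \<Longrightarrow> F x \<in> L"
  shows "op_comp (graph_on L G) (graph_on K F) = graph_on K (\<lambda>x. G (F x))"
  using assms by (auto simp: op_comp_def graph_on_def)

lemma op_diff_graph_on: "op_diff (graph_on K F) (graph_on K G) = graph_on K (\<lambda>x. F x - G x)"
  by (auto simp: op_diff_def graph_on_def)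

section \<open>Ideal membership and separability carried along bounded maps\<close>

lemma operator_ideal_graph_on:
  assumes "operator_ideal \<SS>" and K: "separable_hilbert K" and L: "separable_hilbert L"
    and T: "graph_on K T \<in> \<SS> K" "linear_map_on K K T"
    and S: "bounded_map_on K L S" and R: "bounded_map_on L K R"
  shows "graph_on L (\<lambda>x. S (T (R x))) \<in> \<SS> L"
proof -
  have "graph_on K S \<in> bounded_operators K L" "graph_on L R \<in> bounded_operators L K"
    using K L S R by (auto simp: separable_hilbert_def hilbert_def intro: graph_on_in_bounded_operators)
  then have "op_comp (graph_on K S) (op_comp (graph_on K T) (graph_on L R)) \<in> \<SS> L"
    using assms(1) K L T(1) unfolding operator_ideal_def by blast
  then show ?thesis
    using linear_map_on_in[OF bounded_map_on_linear[OF R]] linear_map_on_in[OF T(2)]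
    by (simp add: op_comp_graph_on)
qed

text \<open>A continuous surjection carries a countable dense set to one. This is needed because a
  boundary triplet only provides a Hilbert space, whereas the ideal is governed by its axioms on
  separable ones.\<close>

lemma separable_hilbert_image:
  assumes K: "separable_hilbert K" and L: "hilbert L" and F: "bounded_map_on K L F" "F ` K = L"
  shows "separable_hilbert L"
proof -
  have "continuous_on K F"
    using K F bounded_map_on_continuous by (auto simp: separable_hilbert_def hilbert_def)
  then have "continuous_map (top_of_set K) (top_of_set L) F"
    using F by auto
  then show ?thesis
    using separable_space_continuous_map_image[of "top_of_set K" "top_of_set L" F] K L F
    by (simp add: separable_hilbert_def)
qed

section \<open>Resolvents as bounded everywhere defined maps\<close>

definition resolvent_map ::
    "'a::chilbert_space set \<Rightarrow> 'a operator \<Rightarrow> complex \<Rightarrow> ('a \<Rightarrow> 'a) \<Rightarrow> bool" where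
  "resolvent_map K T z R \<longleftrightarrow> bounded_map_on K K R \<and> resolvent T z = graph_on K R"

lemma resolvent_setE:
  assumes "z \<in> resolvent_set K T"
  obtains R where "resolvent_map K T z R"
proof -
  have "resolvent T z \<in> bounded_operators K K" using assms by (simp add: resolvent_set_def)
  then show ?thesis
    by (rule bounded_operatorsE) (rule that, simp add: resolvent_map_def)
qed

text \<open>The right-inverse half, (T - z) R = 1; \<open>resolvent_map_eq\<close> is the
  left-inverse half.\<close>

lemma resolvent_map_in:
  assumes R: "resolvent_map K T z R" and x: "x \<in> K"
  shows "(R x, x + z *\<^sub>C R x) \<in> T"
proof -
  have "(x, R x) \<in> resolvent T z" using x R by (auto simp: graph_on_def resolvent_map_def)
  then obtain f' where "x = f' - z *\<^sub>C R x" "(R x, f') \<in> T"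
    by (auto simp: resolvent_def op_shift_def)
  then show ?thesis by (metis diff_add_cancel)
qed

lemma resolvent_map_eq:
  assumes R: "resolvent_map K T z R" and f: "(f, f') \<in> T"
  shows "f' - z *\<^sub>C f \<in> K" "R (f' - z *\<^sub>C f) = f"
proof -
  have "(f' - z *\<^sub>C f, f) \<in> resolvent T z" using f by (auto simp: resolvent_def op_shift_def)
  then show "f' - z *\<^sub>C f \<in> K" "R (f' - z *\<^sub>C f) = f"
    using R by (auto simp: graph_on_def resolvent_map_def)
qed

section \<open>Boundary triplets\<close>

text \<open>The adjoint is cut out by continuous equations, one for each element of T. Its graph,
  with the norm of the product space, is the domain of the adjoint with the graph norm, which makes
  the closed graph theorem applicable to the boundary maps.\<close>

lemma hilbert_adjoint_op:
  assumes K: "hilbert K"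
  shows "hilbert (adjoint_op K T)"
proof -
  have "adjoint_op K T = (K \<times> K) \<inter>
      (\<Inter>p\<in>T. {q. cinner (snd p) (fst q) = cinner (fst p) (snd q)})"
    by (fastforce simp: adjoint_op_def)
  moreover have "closed \<dots>"
    by (intro closed_Int closed_Times hilbert_closed[OF K] closed_INT ballI closed_Collect_eq
        continuous_intros)
  moreover have "csubspace (adjoint_op K T)"
    using csubspaceD[OF hilbert_csubspace[OF K]]
    by (fastforce simp: csubspace_def adjoint_op_def zero_prod_def scaleC_prod_def cinner_add_right
        cinner_scaleC_right)
  ultimately show ?thesis by (simp add: hilbert_def)
qed

lemma csubspace_Domain:
  assumes "csubspace T"
  shows "csubspace (Domain T)"
proof -
  have "(0, 0) \<in> T" using csubspace_0[OF assms] by (simp add: zero_prod_def)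
  moreover have "x + y \<in> Domain T" if "(x, x') \<in> T" "(y, y') \<in> T" for x x' y y'
    using csubspace_add[OF assms that] by auto
  moreover have "a *\<^sub>C x \<in> Domain T" if "(x, x') \<in> T" for a x x'
    using csubspace_scale[OF assms that, of a] by (auto simp: scaleC_prod_def)
  ultimately show ?thesis unfolding csubspace_def by blast
qed

lemma hilbert_defect_subspace:
  assumes K: "hilbert K"
  shows "hilbert (defect_subspace K A z)"
proof -
  have "continuous_on UNIV (\<lambda>f :: 'a. z *\<^sub>C f)"
    by (intro bounded_map_on_continuous[of _ UNIV] bounded_map_on_scale bounded_map_on_ident)
      (auto simp: csubspace_def)
  then have "closed ((\<lambda>f. (f, z *\<^sub>C f)) -` adjoint_op K A)"
    by (intro continuous_closed_vimage hilbert_closed[OF hilbert_adjoint_op[OF K]])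
      (auto intro!: continuous_intros simp: continuous_on_eq_continuous_at)
  moreover have "csubspace (defect_subspace K A z)"
    using csubspaceD[OF hilbert_csubspace[OF hilbert_adjoint_op[OF K, of A]]]
    by (fastforce simp: csubspace_def defect_subspace_def zero_prod_def scaleC_prod_def
        scaleC_add_right scaleC_scaleC mult.commute)
  ultimately show ?thesis by (simp add: hilbert_def defect_subspace_def vimage_def)
qed

lemma boundary_tripletD:
  assumes "boundary_triplet K A L G0 G1"
  shows boundary_triplet_hilbert: "hilbert L"
    and boundary_triplet_linear: "linear_map_on (Domain (adjoint_op K A)) L G0"
      "linear_map_on (Domain (adjoint_op K A)) L G1"
    and boundary_triplet_Green: "\<And>f f' g g'. (f, f') \<in> adjoint_op K A \<Longrightarrow> (g, g') \<in> adjoint_op K A \<Longrightarrow>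
      cinner f' g - cinner f g' = cinner (G1 f) (G0 g) - cinner (G0 f) (G1 g)"
  using assms by (auto simp: boundary_triplet_def)

lemma boundary_triplet_onto:
  assumes "boundary_triplet K A L G0 G1" "a \<in> L" "b \<in> L"
  obtains f f' where "(f, f') \<in> adjoint_op K A" "G0 f = a" "G1 f = b"
proof -
  have "(b, a) \<in> (\<lambda>f. (G1 f, G0 f)) ` Domain (adjoint_op K A)"
    using assms by (simp add: boundary_triplet_def)
  then show ?thesis using that by auto
qed

text \<open>
  By surjectivity, Green's identity determines the boundary values of an element of the adjoint,
  and it is preserved under limits; hence the boundary maps have a closed graph.
\<close>
lemma boundary_triplet_bounded:
  assumes K: "hilbert K" and triplet: "boundary_triplet K A L G0 G1"
  shows "bounded_map_on (adjoint_op K A) (L \<times> L) (\<lambda>p. (G0 (fst p), G1 (fst p)))"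
proof (rule closed_graph[OF hilbert_adjoint_op[OF K]])
  let ?A = "adjoint_op K A"
  note L = boundary_triplet_hilbert[OF triplet]
  note lin = boundary_triplet_linear[OF triplet]
  show "linear_map_on ?A (L \<times> L) (\<lambda>p. (G0 (fst p), G1 (fst p)))"
    unfolding linear_map_on_def
    using linear_map_onD[OF lin(1)] linear_map_onD[OF lin(2)]
    by (auto simp: scaleC_prod_def Domain.DomainI)
  \<comment> \<open>The right side replaces the boundary values in Green's identity by a candidate
    pair \<open>snd s\<close>; each such equation is closed.\<close>
  have "{(p, (G0 (fst p), G1 (fst p))) | p. p \<in> ?A} = (?A \<times> (L \<times> L)) \<inter>
     (\<Inter>r\<in>?A. {s. cinner (snd (fst s)) (fst r) - cinner (fst (fst s)) (snd r)
        = cinner (snd (snd s)) (G0 (fst r)) - cinner (fst (snd s)) (G1 (fst r))})"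
    (is "?G = ?R")
  proof
    show "?G \<subseteq> ?R"
      using boundary_triplet_Green[OF triplet] linear_map_on_in[OF lin(1)] linear_map_on_in[OF lin(2)]
      by (auto simp: Domain.DomainI)
    show "?R \<subseteq> ?G"
    proof
      fix s assume s: "s \<in> ?R"
      obtain f f' a b where s_eq: "s = ((f, f'), (a, b))" by (metis surj_pair)
      have ff': "(f, f') \<in> ?A" and ab: "a \<in> L" "b \<in> L"
        and eq: "\<And>g g'. (g, g') \<in> ?A \<Longrightarrow>
          cinner f' g - cinner f g' = cinner b (G0 g) - cinner a (G1 g)"
        using s by (auto simp: s_eq)
      have in_L: "G0 f \<in> L" "G1 f \<in> L"
        using linear_map_on_in[OF lin(1)] linear_map_on_in[OF lin(2)] ff' by (auto simp: Domain.DomainI)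
      have diff: "cinner (b - G1 f) (G0 g) = cinner (a - G0 f) (G1 g)" if "(g, g') \<in> ?A" for g g'
        using eq[OF that] boundary_triplet_Green[OF triplet ff' that]
        by (simp add: cinner_diff_left algebra_simps)
      note sub = csubspace_diff[OF hilbert_csubspace[OF L]]
      note zero = csubspace_0[OF hilbert_csubspace[OF L]]
      \<comment> \<open>Prescribing one boundary value of g as the discrepancy itself and the other
        as 0 reduces \<open>diff\<close> to a vanishing squared norm.\<close>
      obtain g g' where "(g, g') \<in> ?A" "G0 g = b - G1 f" "G1 g = 0"
        using boundary_triplet_onto[OF triplet sub[OF ab(2) in_L(2)] zero] .
      then have "(b - G1 f) \<bullet> (b - G1 f) = 0"
        using diff[of g g'] by (simp add: inner_eq_Re_cinner)
      then have "b = G1 f" by simp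
      moreover obtain g g' where "(g, g') \<in> ?A" "G0 g = 0" "G1 g = a - G0 f"
        using boundary_triplet_onto[OF triplet zero sub[OF ab(1) in_L(1)]] .
      then have "(a - G0 f) \<bullet> (a - G0 f) = 0"
        using diff[of g g'] by (simp add: inner_eq_Re_cinner)
      then have "a = G0 f" by simp
      ultimately show "s \<in> ?G" using ff' by (auto simp: s_eq)
    qed
  qed
  moreover have "closed ?R"
    by (intro closed_Int closed_Times hilbert_closed[OF L] hilbert_closed[OF hilbert_adjoint_op[OF K]]
        closed_INT ballI closed_Collect_eq continuous_intros)
  ultimately show "closed {(p, (G0 (fst p), G1 (fst p))) | p. p \<in> ?A}" by simp
qed

text \<open>Continuity in the graph norm forces a bound on F' as well, which plays the role of A^*
  F. The two uses are F = R with F' h = h + z R h, and the inclusion of the defect subspace with F'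
  d = z d.\<close>

lemma boundary_map_compose_bounded:
  assumes K: "hilbert K" and triplet: "boundary_triplet K A L G0 G1"
    and F: "bounded_map_on M K F" and F': "bounded_map_on M K F'"
    and in_adj: "\<And>x. x \<in> M \<Longrightarrow> (F x, F' x) \<in> adjoint_op K A"
  shows "bounded_map_on M L (\<lambda>x. G0 (F x))" "bounded_map_on M L (\<lambda>x. G1 (F x))"
proof -
  note lin = boundary_triplet_linear[OF triplet]
  obtain C where C: "C \<ge> 0" "\<And>p. p \<in> adjoint_op K A \<Longrightarrow> norm (G0 (fst p), G1 (fst p)) \<le> C * norm p"
    using bounded_map_on_bound[OF boundary_triplet_bounded[OF K triplet]] by blast
  obtain D where D: "D \<ge> 0" "\<And>x. x \<in> M \<Longrightarrow> norm (F x) \<le> D * norm x"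
    using bounded_map_on_bound[OF F] by blast
  obtain D' where D': "D' \<ge> 0" "\<And>x. x \<in> M \<Longrightarrow> norm (F' x) \<le> D' * norm x"
    using bounded_map_on_bound[OF F'] by blast
  have bound: "norm (G0 (F x), G1 (F x)) \<le> (C * (D + D')) * norm x" if x: "x \<in> M" for x
  proof -
    have "norm (G0 (F x), G1 (F x)) \<le> C * norm (F x, F' x)"
      using C(2)[OF in_adj[OF x]] by simp
    also have "\<dots> \<le> C * (D * norm x + D' * norm x)"
      using order_trans[OF norm_Pair_le add_mono[OF D(2)[OF x] D'(2)[OF x]]] C(1)
      by (rule mult_left_mono)
    finally show ?thesis by (simp add: algebra_simps)
  qed
  have dom: "F x \<in> Domain (adjoint_op K A)" if "x \<in> M" for x using in_adj[OF that] by blast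
  then have "linear_map_on M (Domain (adjoint_op K A)) F"
    using linear_map_onD[OF bounded_map_on_linear[OF F]] by (simp add: linear_map_on_def)
  then have "linear_map_on M L (\<lambda>x. G0 (F x))" "linear_map_on M L (\<lambda>x. G1 (F x))"
    using lin by (auto intro: linear_map_on_compose)
  moreover have "norm (G0 (F x)) \<le> (C * (D + D')) * norm x" "norm (G1 (F x)) \<le> (C * (D + D')) * norm x"
    if "x \<in> M" for x
    using order_trans[OF norm_fst_le bound[OF that]] order_trans[OF norm_snd_le bound[OF that]]
    by blast+
  ultimately show "bounded_map_on M L (\<lambda>x. G0 (F x))" "bounded_map_on M L (\<lambda>x. G1 (F x))"
    unfolding bounded_map_on_def by blast+
qed

lemma extension_opD:
  assumes "(f, f') \<in> extension_op K A G0 G1 B"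
  shows "(f, f') \<in> adjoint_op K A" "(G0 f, G1 f) \<in> B"
  using assms by (auto simp: extension_op_def)

section \<open>Comparing the two resolvent differences\<close>

text \<open>On the domain of A_B the boundary condition gives V h = (B - \<open>\<zeta>\<close>)
  Gamma_0 R h, so Q undoes B - \<open>\<zeta>\<close>.\<close>

lemma boundary_value_map:
  assumes K: "hilbert K" and triplet: "boundary_triplet K A L G0 G1"
    and R: "resolvent_map K (extension_op K A G0 G1 B) z R"
    and Q: "resolvent_map L B \<zeta> Q"
  defines "V \<equiv> \<lambda>h. G1 (R h) - \<zeta> *\<^sub>C G0 (R h)"
  shows "bounded_map_on K L V" "V ` K = L" "\<And>h. h \<in> K \<Longrightarrow> Q (V h) = G0 (R h)"
proof -
  note cK = hilbert_csubspace[OF K]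
  note L = boundary_triplet_hilbert[OF triplet]
  note cL = hilbert_csubspace[OF L]
  have bR: "bounded_map_on K K R" using R by (simp add: resolvent_map_def)
  have in_ext: "(R h, h + z *\<^sub>C R h) \<in> extension_op K A G0 G1 B" if "h \<in> K" for h
    by (rule resolvent_map_in[OF R that])
  have bR': "bounded_map_on K K (\<lambda>h. h + z *\<^sub>C R h)"
    by (intro bounded_map_on_add bounded_map_on_ident bounded_map_on_scale bR cK order_refl)
  note b = boundary_map_compose_bounded[OF K triplet bR bR' extension_opD(1)[OF in_ext]]
  show bV: "bounded_map_on K L V"
    unfolding V_def by (intro bounded_map_on_diff bounded_map_on_scale b cL)
  show "Q (V h) = G0 (R h)" if "h \<in> K" for h
    unfolding V_def by (rule resolvent_map_eq(2)[OF Q extension_opD(2)[OF in_ext[OF that]]])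
  have "\<phi> \<in> V ` K" if \<phi>: "\<phi> \<in> L" for \<phi>
  proof -
    \<comment> \<open>This element of B is realised as the boundary values of some f, which
      therefore lies in the domain of A_B; the preimage of \<open>\<phi>\<close> under V is then
      (A_B - z) f.\<close>
    have Q\<phi>: "(Q \<phi>, \<phi> + \<zeta> *\<^sub>C Q \<phi>) \<in> B" by (rule resolvent_map_in[OF Q \<phi>])
    have "Q \<phi> \<in> L"
      using Q \<phi> by (auto simp: resolvent_map_def bounded_map_on_def linear_map_on_def)
    then have "\<phi> + \<zeta> *\<^sub>C Q \<phi> \<in> L"
      by (intro csubspace_add[OF cL \<phi>] csubspace_scale[OF cL])
    with \<open>Q \<phi> \<in> L\<close> obtain f f' where f: "(f, f') \<in> adjoint_op K A" "G0 f = Q \<phi>"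
      "G1 f = \<phi> + \<zeta> *\<^sub>C Q \<phi>"
      by (rule boundary_triplet_onto[OF triplet])
    then have ext: "(f, f') \<in> extension_op K A G0 G1 B" using Q\<phi> by (simp add: extension_op_def)
    have "V (f' - z *\<^sub>C f) = \<phi>" by (simp add: V_def resolvent_map_eq(2)[OF R ext] f)
    then show ?thesis using resolvent_map_eq(1)[OF R ext] by (metis imageI)
  qed
  then show "V ` K = L" using linear_map_on_in[OF bounded_map_on_linear[OF bV]] by auto
qed

text \<open>
  The kernel of the map below on the domain of the adjoint is the domain of the extension \<open>A\<^sub>B\<close>,
  which the defect subspace at a regular point of \<open>A\<^sub>B\<close> complements.
\<close>
lemma defect_boundary_map:
  assumes K: "hilbert K" and triplet: "boundary_triplet K A L G0 G1"
    and R: "resolvent_map K (extension_op K A G0 G1 B) z R"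
    and Q: "resolvent_map L B \<zeta> Q"
  defines "\<Lambda> \<equiv> \<lambda>d. G0 d - Q (G1 d - \<zeta> *\<^sub>C G0 d)"
  shows "bounded_map_on (defect_subspace K A z) L \<Lambda>"
    and "bij_betw \<Lambda> (defect_subspace K A z) L"
proof -
  let ?N = "defect_subspace K A z"
  note cK = hilbert_csubspace[OF K]
  note L = boundary_triplet_hilbert[OF triplet]
  note cL = hilbert_csubspace[OF L]
  note cA = hilbert_csubspace[OF hilbert_adjoint_op[OF K, of A]]
  note N = hilbert_defect_subspace[OF K, of A z]
  note lin = boundary_triplet_linear[OF triplet]
  have NK: "?N \<subseteq> K" by (auto simp: defect_subspace_def adjoint_op_def)
  have N_adj: "\<And>d. d \<in> ?N \<Longrightarrow> (d, z *\<^sub>C d) \<in> adjoint_op K A" by (simp add: defect_subspace_def)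
  have bQ: "bounded_map_on L L Q" using Q by (simp add: resolvent_map_def)
  note b = boundary_map_compose_bounded[OF K triplet bounded_map_on_ident[OF NK]
      bounded_map_on_scale[OF bounded_map_on_ident[OF NK] cK] N_adj]
  show b\<Lambda>: "bounded_map_on ?N L \<Lambda>"
    unfolding \<Lambda>_def
    by (intro bounded_map_on_diff bounded_map_on_compose[OF _ bQ] bounded_map_on_scale b cL)
  note l\<Lambda> = bounded_map_on_linear[OF b\<Lambda>]
  \<comment> \<open>If Lambda vanishes at d, the boundary values of d satisfy the condition defining
    A_B. Then d is annihilated by A_B - z, which is injective.\<close>
  have zero: "d = 0" if d: "d \<in> ?N" "\<Lambda> d = 0" for d
  proof -
    have "G1 d - \<zeta> *\<^sub>C G0 d \<in> L"
      using d(1) linear_map_on_in[OF lin(1)] linear_map_on_in[OF lin(2)] N_adj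
      by (intro csubspace_diff[OF cL] csubspace_scale[OF cL]) blast+
    from resolvent_map_in[OF Q this] have "(G0 d, G1 d) \<in> B"
      using d(2) by (simp add: \<Lambda>_def)
    then have "(d, z *\<^sub>C d) \<in> extension_op K A G0 G1 B"
      using N_adj[OF d(1)] by (simp add: extension_op_def)
    from resolvent_map_eq(2)[OF R this] show "d = 0"
      using R linear_map_on_0[OF cK] by (auto simp: resolvent_map_def bounded_map_on_def)
  qed
  have "inj_on \<Lambda> ?N"
  proof (rule inj_onI)
    fix d e assume de: "d \<in> ?N" "e \<in> ?N" "\<Lambda> d = \<Lambda> e"
    have "d - e = 0"
      by (rule zero) (use de csubspace_diff[OF hilbert_csubspace[OF N]]
          linear_map_on_diff[OF hilbert_csubspace[OF N] l\<Lambda>] in simp_all)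
    then show "d = e" by simp
  qed
  moreover have "y \<in> \<Lambda> ` ?N" if y: "y \<in> L" for y
  proof -
    \<comment> \<open>With these boundary values the argument of Q vanishes and the formula for
      Lambda yields y at f. Subtracting \<open>R h\<close> with h = (A^* - z) f moves f into the
      defect subspace and leaves the value unchanged, since the formula vanishes on the domain of
      A_B.\<close>
    obtain f f' where f: "(f, f') \<in> adjoint_op K A" "G0 f = y" "G1 f = \<zeta> *\<^sub>C y"
      using boundary_triplet_onto[OF triplet y csubspace_scale[OF cL y]] .
    define h where "h = f' - z *\<^sub>C f"
    have h: "h \<in> K"
      using f(1) csubspaceD[OF cK] csubspace_diff[OF cK] by (auto simp: h_def adjoint_op_def)
    note Rh = resolvent_map_in[OF R h]
    have "(f, f') - (R h, h + z *\<^sub>C R h) \<in> adjoint_op K A"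
      by (rule csubspace_diff[OF cA f(1) extension_opD(1)[OF Rh]])
    then have "(f - R h, z *\<^sub>C (f - R h)) \<in> adjoint_op K A"
      by (simp add: h_def scaleC_diff_right)
    then have d: "f - R h \<in> ?N" by (simp add: defect_subspace_def)
    have dom: "f \<in> Domain (adjoint_op K A)" "R h \<in> Domain (adjoint_op K A)"
      using f(1) extension_opD(1)[OF Rh] by blast+
    have G: "G0 (f - R h) = y - G0 (R h)" "G1 (f - R h) = \<zeta> *\<^sub>C y - G1 (R h)"
      using linear_map_on_diff[OF csubspace_Domain[OF cA] lin(1) dom]
        linear_map_on_diff[OF csubspace_Domain[OF cA] lin(2) dom] f by simp_all
    let ?w = "G1 (R h) - \<zeta> *\<^sub>C G0 (R h)"
    have "Q (- ?w) = - Q ?w"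
      using linear_map_on_scale[OF bounded_map_on_linear[OF bQ]
          resolvent_map_eq(1)[OF Q extension_opD(2)[OF Rh]], of "- 1"] by simp
    also have "Q ?w = G0 (R h)" by (rule resolvent_map_eq(2)[OF Q extension_opD(2)[OF Rh]])
    finally have "\<Lambda> (f - R h) = y"
      by (simp add: \<Lambda>_def G scaleC_diff_right)
    then show ?thesis using d by blast
  qed
  ultimately show "bij_betw \<Lambda> ?N L"
    using linear_map_on_in[OF l\<Lambda>] by (auto simp: bij_betw_def)
qed

theorem theorem4p6:
  fixes \<HH> \<H> :: "'a::chilbert_space set"
    and A B1 B2 :: "'a operator"
    and \<Gamma>0 \<Gamma>1 :: "'a \<Rightarrow> 'a"
    and \<SS> :: "'a set \<Rightarrow> 'a operator set"
    and z :: complex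
  assumes "operator_ideal \<SS>"
    and "separable_hilbert \<HH>"
    and "A \<in> closed_operators \<HH>"
    and "symmetric_op \<HH> A"
    and "equal_deficiency_indices \<HH> A"
    and "boundary_triplet \<HH> A \<H> \<Gamma>0 \<Gamma>1"
    and "B1 \<in> closed_operators \<H>"
    and "B2 \<in> closed_operators \<H>"
    and "z \<in> resolvent_set \<HH> (extension_op \<HH> A \<Gamma>0 \<Gamma>1 B1)
           \<inter> resolvent_set \<HH> (extension_op \<HH> A \<Gamma>0 \<Gamma>1 B2)"
    and "resolvent_set \<H> B1 \<inter> resolvent_set \<H> B2 \<noteq> {}"
  shows "\<forall>\<zeta> \<in> resolvent_set \<H> B1 \<inter> resolvent_set \<H> B2.
    op_diff (resolvent (extension_op \<HH> A \<Gamma>0 \<Gamma>1 B1) z)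
            (resolvent (extension_op \<HH> A \<Gamma>0 \<Gamma>1 B2) z) \<in> \<SS> \<HH>
    \<longleftrightarrow> op_diff (resolvent B1 \<zeta>) (resolvent B2 \<zeta>) \<in> \<SS> \<H>"
proof
  fix \<zeta> assume \<zeta>: "\<zeta> \<in> resolvent_set \<H> B1 \<inter> resolvent_set \<H> B2"
  note triplet = assms(6)
  let ?E = "extension_op \<HH> A \<Gamma>0 \<Gamma>1" and ?N = "defect_subspace \<HH> A z"
  have K: "hilbert \<HH>" using assms(2) by (simp add: separable_hilbert_def)
  note cK = hilbert_csubspace[OF K]
  note L = boundary_triplet_hilbert[OF triplet]
  note cL = hilbert_csubspace[OF L]
  note N = hilbert_defect_subspace[OF K, of A z]
  note cA = hilbert_csubspace[OF hilbert_adjoint_op[OF K, of A]]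
  have NK: "?N \<subseteq> \<HH>" by (auto simp: defect_subspace_def adjoint_op_def)
  obtain R1 R2 where R1: "resolvent_map \<HH> (?E B1) z R1" and R2: "resolvent_map \<HH> (?E B2) z R2"
    using assms(9) by (meson IntD1 IntD2 resolvent_setE)
  obtain Q1 Q2 where Q1: "resolvent_map \<H> B1 \<zeta> Q1" and Q2: "resolvent_map \<H> B2 \<zeta> Q2"
    using \<zeta> by (meson IntD1 IntD2 resolvent_setE)
  define V where "V h = \<Gamma>1 (R2 h) - \<zeta> *\<^sub>C \<Gamma>0 (R2 h)" for h
  define \<Lambda> where "\<Lambda> d = \<Gamma>0 d - Q1 (\<Gamma>1 d - \<zeta> *\<^sub>C \<Gamma>0 d)" for d
  define DR where "DR h = R1 h - R2 h" for h
  define DQ where "DQ \<phi> = Q1 \<phi> - Q2 \<phi>" for \<phi>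
  note V = boundary_value_map[OF K triplet R2 Q2, folded V_def]
  note \<Lambda> = defect_boundary_map[OF K triplet R1 Q1, folded \<Lambda>_def]
  have lDR: "linear_map_on \<HH> \<HH> DR" and lDQ: "linear_map_on \<H> \<H> DQ"
    unfolding DR_def DQ_def using R1 R2 Q1 Q2 cK cL
    by (auto simp: resolvent_map_def intro!: bounded_map_on_linear bounded_map_on_diff)
  have DR_eq: "op_diff (resolvent (?E B1) z) (resolvent (?E B2) z) = graph_on \<HH> DR"
    and DQ_eq: "op_diff (resolvent B1 \<zeta>) (resolvent B2 \<zeta>) = graph_on \<H> DQ"
    unfolding DR_def DQ_def using R1 R2 Q1 Q2 by (simp_all add: resolvent_map_def op_diff_graph_on)
  have sepL: "separable_hilbert \<H>" by (rule separable_hilbert_image[OF assms(2) L V(1,2)])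
  obtain W where W: "bounded_map_on \<H> \<HH> W" "\<And>\<phi>. \<phi> \<in> \<H> \<Longrightarrow> V (W \<phi>) = \<phi>"
    using bounded_right_inverse[OF K L V(1,2)] by metis
  obtain T where T: "bounded_map_on \<H> ?N T" "\<And>y. y \<in> \<H> \<Longrightarrow> \<Lambda> (T y) = y"
    using bounded_right_inverse[OF N L \<Lambda>(1) bij_betw_imp_surj_on[OF \<Lambda>(2)]] by metis
  \<comment> \<open>Lambda is bounded only on the defect subspace, while the ideal property asks for
    a factor defined on all of \<open>\<HH>\<close>. Composing with P provides one and changes
    nothing on the range of \<open>DR\<close>.\<close>
  obtain P where P: "bounded_map_on UNIV ?N P" "\<And>d. d \<in> ?N \<Longrightarrow> P d = d"
    using orthogonal_projection[OF N] by metis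
  have core: "DR h \<in> ?N \<and> \<Lambda> (DR h) = DQ (V h)" if h: "h \<in> \<HH>" for h
  proof -
    note r1 = resolvent_map_in[OF R1 h] and r2 = resolvent_map_in[OF R2 h]
    note e1 = extension_opD(1)[OF r1] and e2 = extension_opD(1)[OF r2]
    note lin = boundary_triplet_linear[OF triplet]
    \<comment> \<open>The inhomogeneous term h is common to both elements and cancels, leaving an
      element of the kernel of A^* - z.\<close>
    have "(R1 h, h + z *\<^sub>C R1 h) - (R2 h, h + z *\<^sub>C R2 h) \<in> adjoint_op \<HH> A"
      by (rule csubspace_diff[OF cA e1 e2])
    then have DN: "DR h \<in> ?N" by (simp add: defect_subspace_def DR_def scaleC_diff_right)
    have G: "\<Gamma>0 (DR h) = \<Gamma>0 (R1 h) - \<Gamma>0 (R2 h)" "\<Gamma>1 (DR h) = \<Gamma>1 (R1 h) - \<Gamma>1 (R2 h)"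
      unfolding DR_def
      using linear_map_on_diff[OF csubspace_Domain[OF cA] lin(1)] e1 e2
        linear_map_on_diff[OF csubspace_Domain[OF cA] lin(2)] by blast+
    \<comment> \<open>The counterpart of \<open>V h\<close> for the first extension. Its image under
      \<open>Q1\<close> is \<open>\<Gamma>0 (R1 h)\<close>, which cancels in
      \<open>\<Lambda> (DR h)\<close>.\<close>
    define V1 where "V1 = \<Gamma>1 (R1 h) - \<zeta> *\<^sub>C \<Gamma>0 (R1 h)"
    have V1: "V1 \<in> \<H>" "Q1 V1 = \<Gamma>0 (R1 h)"
      unfolding V1_def using resolvent_map_eq[OF Q1 extension_opD(2)[OF r1]] by auto
    have Vh: "V h \<in> \<H>" using V(2) h by blast
    have "\<Gamma>1 (DR h) - \<zeta> *\<^sub>C \<Gamma>0 (DR h) = V1 - V h"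
      by (simp add: G V1_def V_def scaleC_diff_right)
    then have "\<Lambda> (DR h) = \<Gamma>0 (DR h) - Q1 (V1 - V h)" by (simp add: \<Lambda>_def)
    also have "Q1 (V1 - V h) = Q1 V1 - Q1 (V h)"
      using Q1 linear_map_on_diff[OF cL _ V1(1) Vh]
      unfolding resolvent_map_def bounded_map_on_def by blast
    finally have "\<Lambda> (DR h) = DQ (V h)"
      using V1(2) V(3)[OF h] by (simp add: G DQ_def)
    with DN show ?thesis ..
  qed
  \<comment> \<open>T is chosen only as a right inverse of Lambda; injectivity of Lambda on the
    defect subspace is what allows it to be cancelled on the left.\<close>
  have "T (DQ (V h)) = DR h" if h: "h \<in> \<HH>" for h
  proof (rule inj_onD[OF bij_betw_imp_inj_on[OF \<Lambda>(2)]])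
    have "DQ (V h) \<in> \<H>" using V(2) h linear_map_on_in[OF lDQ] by blast
    then show "\<Lambda> (T (DQ (V h))) = \<Lambda> (DR h)" "T (DQ (V h)) \<in> ?N"
      using T core[OF h] linear_map_on_in[OF bounded_map_on_linear[OF T(1)]] by auto
  qed (use core[OF h] in blast)
  then have DR_factor: "graph_on \<HH> (\<lambda>h. T (DQ (V h))) = graph_on \<HH> DR"
    by (rule graph_on_cong)
  \<comment> \<open>Here V has to be cancelled on the right of \<open>DQ\<close>, so a right inverse
    suffices even though V may have a kernel.\<close>
  have DQ_factor: "graph_on \<H> (\<lambda>\<phi>. \<Lambda> (P (DR (W \<phi>)))) = graph_on \<H> DQ"
  proof (rule graph_on_cong)
    fix \<phi> assume \<phi>: "\<phi> \<in> \<H>"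
    then have "W \<phi> \<in> \<HH>" using linear_map_on_in[OF bounded_map_on_linear[OF W(1)]] by blast
    then show "\<Lambda> (P (DR (W \<phi>))) = DQ \<phi>" using core P(2) W(2)[OF \<phi>] by simp
  qed
  have bT: "bounded_map_on \<H> \<HH> T" by (rule bounded_map_on_subset[OF T(1) order_refl NK])
  have bP: "bounded_map_on \<HH> \<H> (\<lambda>h. \<Lambda> (P h))"
    by (rule bounded_map_on_compose[OF bounded_map_on_subset[OF P(1) subset_UNIV order_refl] \<Lambda>(1)])
  show "op_diff (resolvent (?E B1) z) (resolvent (?E B2) z) \<in> \<SS> \<HH>
    \<longleftrightarrow> op_diff (resolvent B1 \<zeta>) (resolvent B2 \<zeta>) \<in> \<SS> \<H>"
    unfolding DR_eq DQ_eq
  proof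
    assume "graph_on \<HH> DR \<in> \<SS> \<HH>"
    from operator_ideal_graph_on[OF assms(1,2) sepL this lDR bP W(1)]
    show "graph_on \<H> DQ \<in> \<SS> \<H>" by (simp only: DQ_factor)
  next
    assume "graph_on \<H> DQ \<in> \<SS> \<H>"
    from operator_ideal_graph_on[OF assms(1) sepL assms(2) this lDQ bT V(1)]
    show "graph_on \<HH> DR \<in> \<SS> \<HH>" by (simp only: DR_factor)
  qed
qed

end
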